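(* Let $n$ be a positive integer divisible by eight, and let $d_{\mathrm{in}},d_{\mathrm{out}}$ be nonnegative integers such that $d_{\mathrm{in}}\le n/2-1$ and $d_{\mathrm{out}}\le n/2$. If $d_{\mathrm{in}}-d_{\mathrm{out}}\le n/4-1$, then there is a graph $G$ with $n$ nodes and a planted bisection with parameters $d_{\mathrm{in}},d_{\mathrm{out}}$ for which the minimum bisection problem does not recover the planted bisection (i.e. the planted bisection is not the unique bisection of minimum cost).
   Context: Graphs are finite, simple and undirected, with $V=\{1,\dots,n\}$. A bisection of $V$ is a partition of $V$ into two subsets of equal cardinality; its cost is the number of edges of $G$ connecting the two sets. The minimum bisection problem asks for a bisection of minimum cost. A planted bisection is a fixed bisection $V_1,V_2$ of $V$; an optimization problem recovers the planted bisection if its unique optimal solution corresponds to the planted bisection. $G[U]$ denotes the subgraph of $G$ induced by $U\subseteq V$. Let $G_0=(V,E_0)$, where $E_0$ is the set of edges of $G$ with one end in $V_1$ and the other in $V_2$. For a graph $G$ with planted bisection $V_1,V_2$, the parameter $d_{\mathrm{in}}$ is the minimum degree of the nodes of $G[V_1]\cup G[V_2]$, and $d_{\mathrm{out}}$ is the maximum degree of the nodes of $G_0$. *)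

theory Defs
  imports Complex_Main
begin

(* An undirected edge is the two-element set of its ends; a graph is given by a vertex set V and
   an edge set E. *)
type_synonym 'a edge = "'a set"

definition simple_graph :: "'a set \<Rightarrow> 'a edge set \<Rightarrow> bool" where
  "simple_graph V E \<longleftrightarrow> finite V \<and> (\<forall>e\<in>E. e \<subseteq> V \<and> card e = 2)"

definition degree :: "'a edge set \<Rightarrow> 'a \<Rightarrow> nat" where
  "degree E v = card {e \<in> E. v \<in> e}"

definition min_degree :: "'a set \<Rightarrow> 'a edge set \<Rightarrow> nat" where
  "min_degree V E = Min (degree E ` V)"

definition max_degree :: "'a set \<Rightarrow> 'a edge set \<Rightarrow> nat" where
  "max_degree V E = Max (degree E ` V)"

definition induced_edges :: "'a edge set \<Rightarrow> 'a set \<Rightarrow> 'a edge set" where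
  "induced_edges E U = {e \<in> E. e \<subseteq> U}"

definition cut_edges :: "'a edge set \<Rightarrow> 'a set \<Rightarrow> 'a set \<Rightarrow> 'a edge set" where
  "cut_edges E A B = {e \<in> E. \<exists>a\<in>A. \<exists>b\<in>B. e = {a, b}}"

definition bisection :: "'a set \<Rightarrow> 'a set \<Rightarrow> 'a set \<Rightarrow> bool" where
  "bisection V A B \<longleftrightarrow> A \<union> B = V \<and> A \<inter> B = {} \<and> card A = card B"

definition bisection_cost :: "'a edge set \<Rightarrow> 'a set \<Rightarrow> 'a set \<Rightarrow> nat" where
  "bisection_cost E A B = card (cut_edges E A B)"

definition minimum_bisection :: "'a set \<Rightarrow> 'a edge set \<Rightarrow> 'a set \<Rightarrow> 'a set \<Rightarrow> bool" where
  "minimum_bisection V E A B \<longleftrightarrow>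
     bisection V A B \<and>
     (\<forall>A' B'. bisection V A' B' \<longrightarrow> bisection_cost E A B \<le> bisection_cost E A' B')"

(* A bisection is an unordered partition, so (A, B) and (B, A) count as the same solution. *)
definition min_bisection_recovers :: "'a set \<Rightarrow> 'a edge set \<Rightarrow> 'a set \<Rightarrow> 'a set \<Rightarrow> bool" where
  "min_bisection_recovers V E V1 V2 \<longleftrightarrow>
     (\<forall>A B. minimum_bisection V E A B \<longleftrightarrow> {A, B} = {V1, V2})"

definition d_in :: "'a set \<Rightarrow> 'a edge set \<Rightarrow> 'a set \<Rightarrow> 'a set \<Rightarrow> nat" where
  "d_in V E V1 V2 = min_degree V (induced_edges E V1 \<union> induced_edges E V2)"

definition d_out :: "'a set \<Rightarrow> 'a edge set \<Rightarrow> 'a set \<Rightarrow> 'a set \<Rightarrow> nat" where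
  "d_out V E V1 V2 = max_degree V (cut_edges E V1 V2)"

end

theory Submission
  imports Defs
begin

text \<open>
  Let \<open>q = n / 4\<close> and split each side of the planted bisection into two halves of size \<open>q\<close>.
  Inside a half put all edges, except that one vertex may have fewer neighbours;
  join different halves by regular bipartite graphs: of degree \<open>c = max 0 (d\<^sub>i\<^sub>n - (q - 1))\<close> on
  the same side, of degree \<open>min d\<^sub>o\<^sub>u\<^sub>t q\<close> between equally placed halves of different sides, and of
  degree \<open>r = max 0 (d\<^sub>o\<^sub>u\<^sub>t - q)\<close> otherwise. The planted bisection costs \<open>2 q d\<^sub>o\<^sub>u\<^sub>t\<close>, while
  separating first halves from second halves costs \<open>2 q (c + r)\<close>, and the hypotheses amount to
  \<open>c + r \<le> d\<^sub>o\<^sub>u\<^sub>t\<close>.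
\<close>

section \<open>Graphs given by symmetric relations: degrees and cuts as neighbour counts\<close>

definition edges_of :: "'a set \<Rightarrow> ('a \<Rightarrow> 'a \<Rightarrow> bool) \<Rightarrow> 'a edge set" where
  "edges_of V R = {{a, b} |a b. a \<in> V \<and> b \<in> V \<and> R a b}"

lemma simple_graph_edges_of:
  assumes "finite V" "\<And>a. \<not> R a a"
  shows "simple_graph V (edges_of V R)"
proof -
  have "card {a, b} = 2" if "R a b" for a b
    using that assms(2) by (metis card_2_iff)
  then show ?thesis
    using assms(1) unfolding simple_graph_def edges_of_def by auto
qed

text \<open>Sending a neighbour \<open>u\<close> to \<open>{v, u}\<close> is a bijection onto the
  edges at \<open>v\<close>. Symmetry of \<open>R\<close> covers the edges that arise from a pair
  with \<open>v\<close> in second place.\<close>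

lemma degree_edges_of:
  assumes "\<And>a b. R a b \<Longrightarrow> R b a" "v \<in> V"
  shows "degree (edges_of V R) v = card {u \<in> V. R v u}"
proof -
  have "bij_betw (\<lambda>u. {v, u}) {u \<in> V. R v u} {e \<in> edges_of V R. v \<in> e}"
  proof (rule bij_betw_imageI)
    show "inj_on (\<lambda>u. {v, u}) {u \<in> V. R v u}"
      by (auto simp: inj_on_def doubleton_eq_iff)
    show "(\<lambda>u. {v, u}) ` {u \<in> V. R v u} = {e \<in> edges_of V R. v \<in> e}"
    proof (intro subset_antisym subsetI)
      fix e assume "e \<in> {e \<in> edges_of V R. v \<in> e}"
      then obtain a b where ab: "e = {a, b}" "a \<in> V" "b \<in> V" "R a b" "v = a \<or> v = b"
        unfolding edges_of_def by auto
      then have "e = {v, b} \<and> R v b \<or> e = {v, a} \<and> R v a"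
        using assms(1) by (auto simp: insert_commute)
      then show "e \<in> (\<lambda>u. {v, u}) ` {u \<in> V. R v u}"
        using ab by auto
    qed (use assms(2) in \<open>auto simp: edges_of_def\<close>)
  qed
  then show ?thesis
    unfolding degree_def by (simp add: bij_betw_same_card)
qed

lemma induced_edges_of_sides:
  "induced_edges (edges_of V R) {v \<in> V. \<not> f v} \<union> induced_edges (edges_of V R) {v \<in> V. f v}
    = edges_of V (\<lambda>a b. R a b \<and> f a = f b)"
  unfolding induced_edges_def edges_of_def by (auto; blast)

lemma cut_edges_of_sides:
  assumes "\<And>a b. R a b \<Longrightarrow> R b a"
  shows "cut_edges (edges_of V R) {v \<in> V. \<not> f v} {v \<in> V. f v}
    = edges_of V (\<lambda>a b. R a b \<and> f a \<noteq> f b)"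
proof (intro subset_antisym subsetI)
  fix e assume "e \<in> edges_of V (\<lambda>a b. R a b \<and> f a \<noteq> f b)"
  then obtain a b where ab: "e = {a, b}" "a \<in> V" "b \<in> V" "R a b" "f a \<noteq> f b"
    unfolding edges_of_def by auto
  then have "e = {b, a}" by auto
  with ab show "e \<in> cut_edges (edges_of V R) {v \<in> V. \<not> f v} {v \<in> V. f v}"
    unfolding cut_edges_def edges_of_def by (cases "f a") blast+
next
  fix e assume "e \<in> cut_edges (edges_of V R) {v \<in> V. \<not> f v} {v \<in> V. f v}"
  then obtain a b where ab: "a \<in> V" "b \<in> V" "\<not> f a" "f b" "e = {a, b}" "e \<in> edges_of V R"
    unfolding cut_edges_def by auto
  then have "R a b"
    using assms unfolding edges_of_def by (auto simp: doubleton_eq_iff)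
  with ab show "e \<in> edges_of V (\<lambda>a b. R a b \<and> f a \<noteq> f b)"
    unfolding edges_of_def by blast
qed

text \<open>Each cut edge has exactly one end where \<open>f\<close> is false, so it can be oriented
  from that end in one way; cut edges then correspond to the pairs in a dependent sum.\<close>

lemma bisection_cost_edges_of:
  assumes "finite V" "\<And>a b. R a b \<Longrightarrow> R b a"
  shows "bisection_cost (edges_of V R) {v \<in> V. \<not> f v} {v \<in> V. f v}
    = (\<Sum>a\<in>{v \<in> V. \<not> f v}. card {b \<in> V. f b \<and> R a b})"
proof -
  let ?S = "SIGMA a:{v \<in> V. \<not> f v}. {b \<in> V. f b \<and> R a b}"
  have "bij_betw (\<lambda>(a, b). {a, b}) ?S (cut_edges (edges_of V R) {v \<in> V. \<not> f v} {v \<in> V. f v})"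
  proof (rule bij_betw_imageI)
    show "inj_on (\<lambda>(a, b). {a, b}) ?S"
      by (auto simp: inj_on_def doubleton_eq_iff)
    show "(\<lambda>(a, b). {a, b}) ` ?S = cut_edges (edges_of V R) {v \<in> V. \<not> f v} {v \<in> V. f v}"
    proof (intro subset_antisym subsetI)
      fix e assume "e \<in> cut_edges (edges_of V R) {v \<in> V. \<not> f v} {v \<in> V. f v}"
      then obtain a b where ab: "a \<in> V" "b \<in> V" "\<not> f a" "f b" "e = {a, b}" "e \<in> edges_of V R"
        unfolding cut_edges_def by auto
      then have "R a b"
        using assms(2) unfolding edges_of_def by (auto simp: doubleton_eq_iff)
      with ab show "e \<in> (\<lambda>(a, b). {a, b}) ` ?S"
        by (intro image_eqI[where x = "(a, b)"]) auto
    qed (auto simp: cut_edges_def edges_of_def)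
  qed
  then have "bisection_cost (edges_of V R) {v \<in> V. \<not> f v} {v \<in> V. f v} = card ?S"
    unfolding bisection_cost_def by (simp add: bij_betw_same_card)
  also have "\<dots> = (\<Sum>a\<in>{v \<in> V. \<not> f v}. card {b \<in> V. f b \<and> R a b})"
    using assms(1) by (subst card_SigmaI) auto
  finally show ?thesis .
qed

section \<open>Building blocks: regular bipartite graphs and almost complete graphs\<close>

text \<open>Translation by \<open>i\<close> permutes the residues mod \<open>q\<close>, and
  \<open>c\<close> of them lie below \<open>c\<close>. So joining \<open>i\<close> to
  \<open>j\<close> when \<open>(i + j) mod q < c\<close> gives a \<open>c\<close>-regular bipartite
  graph; using the sum rather than the difference makes the relation symmetric.\<close>

lemma card_add_mod_less:
  fixes i q c :: nat
  assumes "c \<le> q"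
  shows "card {j \<in> {..<q}. (i + j) mod q < c} = c"
proof (cases "q = 0")
  case False
  have inj: "inj_on (\<lambda>j. (i + j) mod q) {..<q}"
  proof (rule inj_onI)
    fix x y assume xy: "x \<in> {..<q}" "y \<in> {..<q}" "(i + x) mod q = (i + y) mod q"
    \<comment> \<open>In the integers \<open>i\<close> can be subtracted from both sides without
      truncation.\<close>
    then have "(int i + int x) mod int q = (int i + int y) mod int q"
      by (metis of_nat_add of_nat_mod)
    then have "((int i + int x) - int i) mod int q = ((int i + int y) - int i) mod int q"
      by (rule mod_diff_cong) simp
    then show "x = y" using xy by simp
  qed
  have surj: "(\<lambda>j. (i + j) mod q) ` {..<q} = {..<q}"
    by (rule endo_inj_surj) (use inj False in auto)
  have "bij_betw (\<lambda>j. (i + j) mod q) {j \<in> {..<q}. (i + j) mod q < c} {k \<in> {..<q}. k < c}"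
  proof (rule bij_betw_imageI)
    show "inj_on (\<lambda>j. (i + j) mod q) {j \<in> {..<q}. (i + j) mod q < c}"
      using inj by (rule inj_on_subset) auto
    show "(\<lambda>j. (i + j) mod q) ` {j \<in> {..<q}. (i + j) mod q < c} = {k \<in> {..<q}. k < c}"
      \<comment> \<open>The instance of \<open>surj\<close> is chosen so that only the right-hand
        set is rewritten.\<close>
      unfolding surj[symmetric, THEN arg_cong, of "\<lambda>S. {k \<in> S. k < c}"] by blast
  qed
  then have "card {j \<in> {..<q}. (i + j) mod q < c} = card {k \<in> {..<q}. k < c}"
    by (rule bij_betw_same_card)
  also have "{k \<in> {..<q}. k < c} = {..<c}" using assms by auto
  finally show ?thesis by simp
qed (use assms in simp)

text \<open>For \<open>s < q\<close>, this is the complete graph on \<open>{..<q}\<close> with the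
  neighbours of \<open>0\<close> cut down to \<open>{1..s}\<close>. As \<open>d_in\<close> is a
  minimum, one vertex of degree exactly \<open>s\<close> is enough if the others have at least that
  degree.\<close>

definition near_complete :: "nat \<Rightarrow> nat \<Rightarrow> nat \<Rightarrow> bool" where
  "near_complete s i j \<longleftrightarrow> i \<noteq> j \<and> (i = 0 \<longrightarrow> j \<le> s) \<and> (j = 0 \<longrightarrow> i \<le> s)"

lemma near_complete_sym: "near_complete s i j \<Longrightarrow> near_complete s j i"
  by (auto simp: near_complete_def)

lemma card_near_complete_0:
  assumes "s < q"
  shows "card {j \<in> {..<q}. near_complete s 0 j} = s"
proof -
  have "{j \<in> {..<q}. near_complete s 0 j} = {1..s}"
    using assms by (auto simp: near_complete_def)
  then show ?thesis by simp
qed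

text \<open>A nonzero \<open>i\<close> up to \<open>s\<close> is still joined to \<open>0\<close>
  and to the other indices up to \<open>s\<close>; a larger \<open>i\<close> loses \<open>0\<close>
  but keeps all of \<open>{1..s}\<close>.\<close>

lemma card_near_complete_ge:
  assumes "s < q" "i < q"
  shows "s \<le> card {j \<in> {..<q}. near_complete s i j}"
proof (cases "i = 0")
  case True
  then show ?thesis using card_near_complete_0[OF assms(1)] by simp
next
  case False
  show ?thesis
  proof (cases "i \<le> s")
    case True
    have "s = card ({..s} - {i})" using True by simp
    also have "\<dots> \<le> card {j \<in> {..<q}. near_complete s i j}"
      by (rule card_mono) (use assms True \<open>i \<noteq> 0\<close> in \<open>auto simp: near_complete_def\<close>)
    finally show ?thesis .
  next
    case gt: False
    have "s = card {1..s}" by simp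
    also have "\<dots> \<le> card {j \<in> {..<q}. near_complete s i j}"
      by (rule card_mono) (use assms gt \<open>i \<noteq> 0\<close> in \<open>auto simp: near_complete_def\<close>)
    finally show ?thesis .
  qed
qed

section \<open>Coordinates on the vertices and the obstruction to recovery\<close>

text \<open>A bijection from \<open>V\<close> to triples of two bits and an index below
  \<open>q\<close> gives all three coordinates. The two bits define the planted bisection and its
  competitor.\<close>

lemma blocks_exist:
  assumes "finite V" "card V = 4 * q"
  obtains side half :: "'a \<Rightarrow> bool" and idx :: "'a \<Rightarrow> nat"
  where "\<And>s h. bij_betw idx {v \<in> V. side v = s \<and> half v = h} {..<q}"
proof -
  have "finite ((UNIV :: bool set) \<times> (UNIV :: bool set) \<times> {..<q})"
    by (intro finite_cartesian_product) auto
  moreover have "card V = card ((UNIV :: bool set) \<times> (UNIV :: bool set) \<times> {..<q})"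
    using assms by (simp add: card_cartesian_product)
  ultimately obtain pos where pos: "bij_betw pos V ((UNIV :: bool set) \<times> (UNIV :: bool set) \<times> {..<q})"
    using finite_same_card_bij[OF assms(1)] by blast
  have "bij_betw (snd \<circ> snd \<circ> pos) {v \<in> V. fst (pos v) = s \<and> fst (snd (pos v)) = h} {..<q}"
    for s h
  proof (rule bij_betw_imageI)
    show "inj_on (snd \<circ> snd \<circ> pos) {v \<in> V. fst (pos v) = s \<and> fst (snd (pos v)) = h}"
      using bij_betw_imp_inj_on[OF pos] by (auto simp: inj_on_def prod_eq_iff)
    show "(snd \<circ> snd \<circ> pos) ` {v \<in> V. fst (pos v) = s \<and> fst (snd (pos v)) = h} = {..<q}"
    proof (intro subset_antisym subsetI)
      fix j assume "j \<in> {..<q}"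
      then obtain v where "v \<in> V" "pos v = (s, h, j)"
        using bij_betw_imp_surj_on[OF pos] by (metis (no_types, lifting) SigmaI UNIV_I imageE)
      then show "j \<in> (snd \<circ> snd \<circ> pos) ` {v \<in> V. fst (pos v) = s \<and> fst (snd (pos v)) = h}"
        by (intro image_eqI[where x = v]) auto
    next
      fix j assume "j \<in> (snd \<circ> snd \<circ> pos) ` {v \<in> V. fst (pos v) = s \<and> fst (snd (pos v)) = h}"
      then obtain v where "v \<in> V" "j = snd (snd (pos v))" by auto
      then show "j \<in> {..<q}"
        using bij_betwE[OF pos] by (metis mem_Times_iff)
    qed
  qed
  then show thesis
    using that[where side = "\<lambda>v. fst (pos v)" and half = "\<lambda>v. fst (snd (pos v))"] by blast
qed

text \<open>A tie is enough: if the planted bisection were optimal, a different bisection of no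
  larger cost would be optimal too, against uniqueness.\<close>

lemma not_recovers_if_cheaper:
  assumes "bisection V A B" "bisection_cost E A B \<le> bisection_cost E V1 V2" "{A, B} \<noteq> {V1, V2}"
  shows "\<not> min_bisection_recovers V E V1 V2"
proof
  assume rec: "min_bisection_recovers V E V1 V2"
  then have "minimum_bisection V E V1 V2"
    unfolding min_bisection_recovers_def by blast
  then have "minimum_bisection V E A B"
    using assms(1,2) unfolding minimum_bisection_def by (meson order_trans)
  then show False
    using rec assms(3) unfolding min_bisection_recovers_def by blast
qed

section \<open>The construction and its parameters\<close>

text \<open>The bound on the difference of degrees is written as a sum, so that subtraction of
  naturals cannot truncate it.\<close>

lemma unrecoverable_planted_bisection:
  fixes V :: "'a set" and q din dout :: nat
  assumes V: "finite V" "card V = 4 * q" and q: "q > 0"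
    and din: "din \<le> 2 * q - 1" and dout: "dout \<le> 2 * q" and diff: "din \<le> dout + (q - 1)"
  shows "\<exists>E V1 V2. simple_graph V E \<and> bisection V V1 V2 \<and> d_in V E V1 V2 = din \<and>
    d_out V E V1 V2 = dout \<and> \<not> min_bisection_recovers V E V1 V2"
proof -
  define s where "s = min din (q - 1)"
  \<comment> \<open>Truncated subtraction supplies the maximum with 0, here and in
    \<open>r\<close>.\<close>
  define c where "c = din - (q - 1)"
  define t where "t = min dout q"
  define r where "r = dout - q"
  \<comment> \<open>The last bound has two cases. If \<open>dout \<le> q\<close>, then
    \<open>r = 0\<close> and \<open>diff\<close> gives \<open>c \<le> dout\<close>; otherwise
    \<open>r = dout - q\<close>, and \<open>c \<le> q\<close> suffices.\<close>
  have bounds: "s < q" "c \<le> q" "t \<le> q" "r \<le> q" "s + c = din" "t + r = dout" "c + r \<le> dout"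
    using q din dout diff by (auto simp: s_def c_def t_def r_def)
  obtain side half :: "'a \<Rightarrow> bool" and idx :: "'a \<Rightarrow> nat"
    where blk: "\<And>x y. bij_betw idx {v \<in> V. side v = x \<and> half v = y} {..<q}"
    using blocks_exist[OF V] by metis
  have idx_less: "idx v < q" if "v \<in> V" for v
    using bij_betwE[OF blk[of "side v" "half v"]] that by auto
  have card_blk: "card {u \<in> V. side u = x \<and> half u = y \<and> P (idx u)} = card {j \<in> {..<q}. P j}"
    for x y P
  proof -
    have "bij_betw idx {u \<in> V. side u = x \<and> half u = y \<and> P (idx u)} {j \<in> {..<q}. P j}"
    proof (rule bij_betw_imageI)
      show "inj_on idx {u \<in> V. side u = x \<and> half u = y \<and> P (idx u)}"
        using bij_betw_imp_inj_on[OF blk[of x y]] by (rule inj_on_subset) auto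
      show "idx ` {u \<in> V. side u = x \<and> half u = y \<and> P (idx u)} = {j \<in> {..<q}. P j}"
        unfolding bij_betw_imp_surj_on[OF blk[of x y], symmetric] by blast
    qed
    then show ?thesis by (rule bij_betw_same_card)
  qed
  \<comment> \<open>Within a block the modular relation could create loops, so
    \<open>near_complete\<close> is used there; between different blocks loops cannot occur.\<close>
  define R where "R u v \<longleftrightarrow>
    (if side u = side v
     then (if half u = half v then near_complete s (idx u) (idx v)
           else (idx u + idx v) mod q < c)
     else (idx u + idx v) mod q < (if half u = half v then t else r))" for u v
  have R_sym: "R v u" if "R u v" for u v
    using that near_complete_sym unfolding R_def by (auto simp: add.commute split: if_splits)
  have R_irrefl: "\<not> R u u" for u
    by (simp add: R_def near_complete_def)
  let ?E = "edges_of V R"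
  let ?V1 = "{v \<in> V. \<not> side v}" and ?V2 = "{v \<in> V. side v}"
  let ?A = "{v \<in> V. \<not> half v}" and ?B = "{v \<in> V. half v}"
  let ?N = "\<lambda>v x y. {u \<in> V. side u = x \<and> half u = y \<and> R v u}"
  have N_in: "card (?N v (side v) (half v)) = card {j \<in> {..<q}. near_complete s (idx v) j}" for v
    by (subst card_blk[of "side v" "half v", symmetric])
      (rule arg_cong[where f = card], auto simp: R_def)
  have N_c: "card (?N v (side v) (\<not> half v)) = c" for v
  proof -
    have "?N v (side v) (\<not> half v)
        = {u \<in> V. side u = side v \<and> half u = (\<not> half v) \<and> (idx v + idx u) mod q < c}"
      by (auto simp: R_def)
    then show ?thesis
      using card_blk[of "side v" "\<not> half v" "\<lambda>j. (idx v + j) mod q < c"] card_add_mod_less[OF bounds(2)]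
      by simp
  qed
  have N_t: "card (?N v (\<not> side v) (half v)) = t" for v
  proof -
    have "?N v (\<not> side v) (half v)
        = {u \<in> V. side u = (\<not> side v) \<and> half u = half v \<and> (idx v + idx u) mod q < t}"
      by (auto simp: R_def)
    then show ?thesis
      using card_blk[of "\<not> side v" "half v" "\<lambda>j. (idx v + j) mod q < t"] card_add_mod_less[OF bounds(3)]
      by simp
  qed
  have N_r: "card (?N v (\<not> side v) (\<not> half v)) = r" for v
  proof -
    have "?N v (\<not> side v) (\<not> half v)
        = {u \<in> V. side u = (\<not> side v) \<and> half u = (\<not> half v) \<and> (idx v + idx u) mod q < r}"
      by (auto simp: R_def)
    then show ?thesis
      using card_blk[of "\<not> side v" "\<not> half v" "\<lambda>j. (idx v + j) mod q < r"] card_add_mod_less[OF bounds(4)]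
      by simp
  qed
  have card_split: "card {u \<in> V. P u} = card {u \<in> V. g u = x \<and> P u} + card {u \<in> V. g u = (\<not> x) \<and> P u}"
    for P g x
    using V(1) by (subst card_Un_disjoint[symmetric]) (auto intro!: arg_cong[where f = card])
  have deg_in: "degree (induced_edges ?E ?V1 \<union> induced_edges ?E ?V2) v
      = card {j \<in> {..<q}. near_complete s (idx v) j} + c" if "v \<in> V" for v
  proof -
    have "degree (induced_edges ?E ?V1 \<union> induced_edges ?E ?V2) v
        = card {u \<in> V. R v u \<and> side v = side u}"
      unfolding induced_edges_of_sides using that by (intro degree_edges_of) (auto intro: R_sym)
    also have "\<dots> = card (?N v (side v) (half v)) + card (?N v (side v) (\<not> half v))"
      by (subst card_split[of _ half "half v"])
        (intro arg_cong2[where f = "(+)"] arg_cong[where f = card]; auto)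
    finally show ?thesis using N_in N_c by simp
  qed
  have out: "card {u \<in> V. side u = (\<not> side v) \<and> R v u} = dout" for v
  proof -
    have "card {u \<in> V. side u = (\<not> side v) \<and> R v u}
        = card (?N v (\<not> side v) (half v)) + card (?N v (\<not> side v) (\<not> half v))"
      by (subst card_split[of _ half "half v"])
        (intro arg_cong2[where f = "(+)"] arg_cong[where f = card]; auto)
    then show ?thesis using N_t N_r bounds by simp
  qed
  have across: "card {u \<in> V. half u = (\<not> half v) \<and> R v u} = c + r" for v
  proof -
    have "card {u \<in> V. half u = (\<not> half v) \<and> R v u}
        = card (?N v (side v) (\<not> half v)) + card (?N v (\<not> side v) (\<not> half v))"
      by (subst card_split[of _ side "side v"])
        (intro arg_cong2[where f = "(+)"] arg_cong[where f = card]; auto)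
    then show ?thesis using N_c N_r by simp
  qed
  have deg_out: "degree (cut_edges ?E ?V1 ?V2) v = dout" if "v \<in> V" for v
  proof -
    have "cut_edges ?E ?V1 ?V2 = edges_of V (\<lambda>a b. R a b \<and> side a \<noteq> side b)"
      by (rule cut_edges_of_sides) (rule R_sym)
    moreover have "degree (edges_of V (\<lambda>a b. R a b \<and> side a \<noteq> side b)) v
        = card {u \<in> V. R v u \<and> side v \<noteq> side u}"
      using that by (intro degree_edges_of) (auto intro: R_sym)
    ultimately have "degree (cut_edges ?E ?V1 ?V2) v = card {u \<in> V. R v u \<and> side v \<noteq> side u}"
      by simp
    also have "{u \<in> V. R v u \<and> side v \<noteq> side u} = {u \<in> V. side u = (\<not> side v) \<and> R v u}"
      by auto
    finally show ?thesis using out by simp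
  qed
  \<comment> \<open>The vertex of index 0 in a block is the one whose inner degree is exactly
    \<open>din\<close>. Nonemptiness of the blocks also serves to tell the two bisections
    apart.\<close>
  have ne: "\<exists>v\<in>V. side v = x \<and> half v = y \<and> idx v = 0" for x y
  proof -
    have "0 \<in> idx ` {v \<in> V. side v = x \<and> half v = y}"
      using bij_betw_imp_surj_on[OF blk[of x y]] q by simp
    then show ?thesis by auto
  qed
  have card_half_sides: "card {v \<in> V. side v = x} = 2 * q" "card {v \<in> V. half v = x} = 2 * q" for x
    using card_split[of "\<lambda>v. side v = x" half True] card_split[of "\<lambda>v. half v = x" side True]
      card_blk[of x True "\<lambda>_. True"] card_blk[of x False "\<lambda>_. True"]
      card_blk[of True x "\<lambda>_. True"] card_blk[of False x "\<lambda>_. True"]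
    by (simp_all add: conj_commute)
  have "simple_graph V ?E"
    using V(1) R_irrefl by (rule simple_graph_edges_of)
  moreover have "bisection V ?V1 ?V2"
    using card_half_sides(1)[of True] card_half_sides(1)[of False] by (auto simp: bisection_def)
  moreover have "d_in V ?E ?V1 ?V2 = din"
    unfolding d_in_def min_degree_def
  proof (rule Min_eqI)
    show "finite (degree (induced_edges ?E ?V1 \<union> induced_edges ?E ?V2) ` V)"
      using V(1) by simp
    show "din \<le> d" if "d \<in> degree (induced_edges ?E ?V1 \<union> induced_edges ?E ?V2) ` V" for d
      using that deg_in card_near_complete_ge[OF bounds(1) idx_less] bounds(5) by force
    obtain v where v: "v \<in> V" "idx v = 0" using ne by blast
    then have "degree (induced_edges ?E ?V1 \<union> induced_edges ?E ?V2) v = din"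
      using deg_in card_near_complete_0[OF bounds(1)] bounds(5) by simp
    with v show "din \<in> degree (induced_edges ?E ?V1 \<union> induced_edges ?E ?V2) ` V"
      by (intro image_eqI[where x = v]) simp_all
  qed
  moreover have "d_out V ?E ?V1 ?V2 = dout"
  proof -
    have "degree (cut_edges ?E ?V1 ?V2) ` V = (\<lambda>_. dout) ` V"
      using deg_out by (intro image_cong) simp_all
    moreover have "V \<noteq> {}"
      using V(2) q by auto
    ultimately have "degree (cut_edges ?E ?V1 ?V2) ` V = {dout}"
      by auto
    then show ?thesis by (simp add: d_out_def max_degree_def)
  qed
  moreover have "\<not> min_bisection_recovers V ?E ?V1 ?V2"
  proof (rule not_recovers_if_cheaper)
    show "bisection V ?A ?B"
      using card_half_sides(2)[of True] card_half_sides(2)[of False] by (auto simp: bisection_def)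
    \<comment> \<open>Both costs are sums of a constant over \<open>2 * q\<close> vertices, so
      comparing them reduces to \<open>c + r \<le> dout\<close>.\<close>
    have "bisection_cost ?E ?A ?B = (\<Sum>v\<in>?A. card {u \<in> V. half u = (\<not> half v) \<and> R v u})"
      by (subst bisection_cost_edges_of) (auto intro: R_sym V(1))
    also have "\<dots> = 2 * q * (c + r)"
      unfolding across using card_half_sides(2)[of False] by simp
    also have "\<dots> \<le> 2 * q * dout" using bounds by simp
    also have "\<dots> = (\<Sum>v\<in>?V1. card {u \<in> V. side u = (\<not> side v) \<and> R v u})"
      unfolding out using card_half_sides(1)[of False] by simp
    also have "\<dots> = bisection_cost ?E ?V1 ?V2"
      by (subst bisection_cost_edges_of) (auto intro: R_sym V(1))
    finally show "bisection_cost ?E ?A ?B \<le> bisection_cost ?E ?V1 ?V2" .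
    \<comment> \<open>\<open>?A\<close> meets both planted sides: \<open>v\<close> shows that it is
      not \<open>?V1\<close>, and \<open>w\<close> that it is not \<open>?V2\<close>.\<close>
    obtain v w where "v \<in> V" "side v" "\<not> half v" "w \<in> V" "\<not> side w" "\<not> half w"
      using ne[of True False] ne[of False False] by auto
    then have "?A \<noteq> ?V1" "?A \<noteq> ?V2" by blast+
    then show "{?A, ?B} \<noteq> {?V1, ?V2}" by (simp add: doubleton_eq_iff)
  qed
  ultimately show ?thesis by blast
qed

theorem theorem2:
  fixes n din dout :: nat
  assumes "n > 0" and "8 dvd n"
    and "real din \<le> real n / 2 - 1"
    and "real dout \<le> real n / 2"
    and "real din - real dout \<le> real n / 4 - 1"
  shows "\<exists>(E :: nat edge set) V1 V2.
    simple_graph {1..n} E \<and>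
    bisection {1..n} V1 V2 \<and>
    d_in {1..n} E V1 V2 = din \<and>
    d_out {1..n} E V1 V2 = dout \<and>
    \<not> min_bisection_recovers {1..n} E V1 V2"
proof -
  obtain m where m: "n = 8 * m" using assms(2) by blast
  show ?thesis
    \<comment> \<open>Here \<open>2 * m\<close> is \<open>n / 4\<close>, which turns the real
      inequalities into the natural ones required.\<close>
    by (rule unrecoverable_planted_bisection[where q = "2 * m"]) (use assms m in auto)
qed

end
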